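(* (i) Let $S$ be any signed graph on $n\ge 2$ vertices with exactly $2$ distinct adjacency eigenvalues. Then the adjacency spectrum of $S\star_s(K_1,\sigma)$, where $K_1$ is the complete graph on $1$ vertex, consists of exactly $4$ distinct eigenvalues. (ii) Let $S$ be any signed graph on $n\ge 2$ vertices with exactly $2$ distinct adjacency eigenvalues. Then the adjacency spectrum of $S\star_s(K_2,\sigma)$, where $K_2$ is the complete graph on $2$ vertices and $\sigma$ is any sign function on it, consists of exactly $5$ distinct eigenvalues.
   Context: A signed graph $S=(G,\sigma)$ is a finite simple graph $G$ with a sign function $\sigma:E_G\to\{-1,1\}$. Its adjacency matrix $A_S$ has $(i,j)$ entry $\sigma(v_iv_j)$ if $v_i\sim v_j$ and $0$ otherwise; adjacency eigenvalues/spectrum are those of $A_S$. The s-neighbourhood corona $S_1\star_s S_2$ of signed graphs $S_1=(G_1,\sigma_1)$ (vertices $v_1,\dots,v_{n_1}$) and $S_2$ (with $n_2$ vertices) is the signed graph on $n_1(n_2+1)$ vertices obtained by taking one copy of $S_1$ and $n_1$ disjoint copies of $S_2$, and, for each $i$ and each neighbour $v_h$ of $v_i$ in $S_1$, joining $v_h$ to every vertex of the $i$th copy of $S_2$ by an edge of sign $\sigma_1(v_hv_i)$. *)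

theory Defs
  imports "Jordan_Normal_Form.Spectral_Radius"
begin

record 'a sgraph =
  verts :: "'a set"
  edges :: "'a set set"
  sign :: "'a set \<Rightarrow> int"

text \<open>The underlying graph is finite and simple (edges are two-element sets of vertices). The
  values of the sign function outside the edge set are irrelevant.\<close>

definition signed_graph :: "('a, 'm) sgraph_scheme \<Rightarrow> bool" where
  "signed_graph S \<longleftrightarrow> finite (verts S) \<and>
     edges S \<subseteq> {e. e \<subseteq> verts S \<and> card e = 2} \<and>
     sign S ` edges S \<subseteq> {-1, 1}"

definition signed_complete_graph :: "nat \<Rightarrow> ('a, 'm) sgraph_scheme \<Rightarrow> bool" where
  "signed_complete_graph m S \<longleftrightarrow> signed_graph S \<and> card (verts S) = m \<and>
     edges S = {e. e \<subseteq> verts S \<and> card e = 2}"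

text \<open>An enumeration \<open>v\<^sub>1, \<dots>, v\<^sub>n\<close> of the vertices, which fixes the rows and columns of the
  adjacency matrix.\<close>

definition vertex_enum :: "('a, 'm) sgraph_scheme \<Rightarrow> 'a list \<Rightarrow> bool" where
  "vertex_enum S vs \<longleftrightarrow> distinct vs \<and> set vs = verts S"

definition adj_matrix :: "('a, 'm) sgraph_scheme \<Rightarrow> 'a list \<Rightarrow> int mat" where
  "adj_matrix S vs = mat (length vs) (length vs)
     (\<lambda>(i, j). if {vs ! i, vs ! j} \<in> edges S then sign S {vs ! i, vs ! j} else 0)"

text \<open>The set of distinct eigenvalues. They are taken over the complex numbers, so that none is
  excluded by the choice of field.\<close>

definition adj_spectrum :: "('a, 'm) sgraph_scheme \<Rightarrow> 'a list \<Rightarrow> complex set" where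
  "adj_spectrum S vs = spectrum (map_mat of_int (adj_matrix S vs))"

text \<open>The vertex \<open>Inl v\<close> is the vertex \<open>v\<close> of the copy of \<open>S\<close>, and \<open>Inr (v, u)\<close> is the vertex \<open>u\<close>
  in the copy of \<open>T\<close> that belongs to the vertex \<open>v\<close> of \<open>S\<close>. An edge inside a copy of \<open>T\<close> has its sign
  in \<open>T\<close>. Replacing \<open>Inl h\<close> by \<open>h\<close> and \<open>Inr (i, u)\<close> by \<open>i\<close> sends any other edge to the edge of
  \<open>S\<close> from which it takes its sign; see the lemmas below.\<close>

definition s_corona :: "'a sgraph \<Rightarrow> 'b sgraph \<Rightarrow> ('a + 'a \<times> 'b) sgraph"  (infixl \<open>\<star>\<^sub>s\<close> 70) where
  "S \<star>\<^sub>s T =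
    \<lparr> verts = Inl ` verts S \<union> Inr ` (verts S \<times> verts T),
      edges = {{Inl v, Inl w} | v w. {v, w} \<in> edges S}
        \<union> {{Inr (i, u), Inr (i, w)} | i u w. i \<in> verts S \<and> {u, w} \<in> edges T}
        \<union> {{Inl h, Inr (i, u)} | h i u. {h, i} \<in> edges S \<and> u \<in> verts T},
      sign = (\<lambda>e. if e \<subseteq> range Inr then sign T ((snd \<circ> projr) ` e)
                  else sign S (case_sum id fst ` e)) \<rparr>"

lemma sign_s_corona:
  "sign (S \<star>\<^sub>s T) {Inl v, Inl w} = sign S {v, w}"
  "sign (S \<star>\<^sub>s T) {Inr (i, u), Inr (i, w')} = sign T {u, w'}"
  "sign (S \<star>\<^sub>s T) {Inl h, Inr (i, u)} = sign S {h, i}"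
  by (auto simp: s_corona_def)

lemma signed_graph_s_corona:
  assumes "signed_graph S" "signed_graph T"
  shows "signed_graph (S \<star>\<^sub>s T)"
proof -
  have S: "v \<noteq> w \<and> v \<in> verts S \<and> w \<in> verts S \<and> sign S {v, w} \<in> {-1, 1}"
    if "{v, w} \<in> edges S" for v w
    using assms(1) that by (cases "v = w") (auto simp: signed_graph_def)
  have T: "v \<noteq> w \<and> v \<in> verts T \<and> w \<in> verts T \<and> sign T {v, w} \<in> {-1, 1}"
    if "{v, w} \<in> edges T" for v w
    using assms(2) that by (cases "v = w") (auto simp: signed_graph_def)
  have "e \<subseteq> verts (S \<star>\<^sub>s T) \<and> card e = 2 \<and> sign (S \<star>\<^sub>s T) e \<in> {-1, 1}"
    if e: "e \<in> edges (S \<star>\<^sub>s T)" for e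
  proof -
    consider v w where "e = {Inl v, Inl w}" "{v, w} \<in> edges S"
      | i u w where "e = {Inr (i, u), Inr (i, w)}" "i \<in> verts S" "{u, w} \<in> edges T"
      | h i u where "e = {Inl h, Inr (i, u)}" "{h, i} \<in> edges S" "u \<in> verts T"
      using e by (auto simp: s_corona_def)
    then show ?thesis
    proof cases
      case 1
      with S[OF 1(2)] show ?thesis by (simp only: sign_s_corona) (simp add: s_corona_def)
    next
      case 2
      with T[OF 2(3)] show ?thesis by (simp only: sign_s_corona) (simp add: s_corona_def)
    next
      case 3
      with S[OF 3(2)] show ?thesis by (simp only: sign_s_corona) (simp add: s_corona_def)
    qed
  qed
  moreover have "finite (verts (S \<star>\<^sub>s T))"
    using assms by (simp add: s_corona_def signed_graph_def)
  ultimately show ?thesis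
    unfolding signed_graph_def by blast
qed

lemma card_verts_s_corona:
  assumes "finite (verts S)" "finite (verts T)"
  shows "card (verts (S \<star>\<^sub>s T)) = card (verts S) * (card (verts T) + 1)"
proof -
  have "card (verts (S \<star>\<^sub>s T)) =
      card (Inl ` verts S :: ('a + 'a \<times> 'b) set) + card (Inr ` (verts S \<times> verts T) :: ('a + 'a \<times> 'b) set)"
    unfolding s_corona_def using assms by (simp, subst card_Un_disjoint) auto
  then show ?thesis
    by (simp add: card_image card_cartesian_product)
qed

end

theory Submission imports Defs begin

text \<open>An eigenvector of \<open>S \<star>\<^sub>s T\<close> either vanishes on \<open>S\<close> and sums to zero on every copy of
  \<open>T\<close>, in which case its eigenvalue belongs to \<open>T\<close>, or summing it over the copies of \<open>T\<close> yields a
  quadratic polynomial in the adjacency matrix of \<open>S\<close> with nontrivial kernel. When all rows of \<open>T\<close>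
  have sum \<open>s\<close>, each eigenvalue \<open>\<theta>\<close> of \<open>S\<close> therefore contributes the two roots of
  \<open>(\<mu> - \<theta>) (\<mu> - s) = \<bar>T\<bar> \<theta>\<^sup>2\<close>. It remains to exclude coincidences. If \<open>a \<noteq> b\<close> are the
  eigenvalues of \<open>S\<close>, with multiplicities \<open>k\<close> and \<open>m\<close>, then \<open>k a + m b = 0\<close>, while
  \<open>k a\<^sup>2 + m b\<^sup>2\<close> and \<open>k a\<^sup>3 + m b\<^sup>3\<close> are rational integers; as \<open>a\<close> and \<open>b\<close> are algebraic integers, they are
  either nonzero integers or square roots \<open>\<plusminus> \<surd>N\<close>, and every coincidence amounts to a
  Diophantine equation without solutions.\<close>

subsection \<open>Traces and eigenvalues of integer matrices\<close>

definition mat_trace :: "'a :: comm_monoid_add mat \<Rightarrow> 'a" where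
  "mat_trace A = (\<Sum>i<dim_row A. A $$ (i, i))"

lemma mat_trace_mult_comm:
  fixes A B :: "'a :: comm_semiring_0 mat"
  assumes "A \<in> carrier_mat n n" "B \<in> carrier_mat n n"
  shows "mat_trace (A * B) = mat_trace (B * A)"
proof -
  have "mat_trace (A * B) = (\<Sum>i<n. \<Sum>j<n. A $$ (i, j) * B $$ (j, i))"
    using assms by (simp add: mat_trace_def scalar_prod_def atLeast0LessThan)
  also have "\<dots> = (\<Sum>j<n. \<Sum>i<n. B $$ (j, i) * A $$ (i, j))"
    by (subst sum.swap) (simp add: mult.commute)
  also have "\<dots> = mat_trace (B * A)"
    using assms by (simp add: mat_trace_def scalar_prod_def atLeast0LessThan)
  finally show ?thesis .
qed

lemma mat_trace_similar:
  fixes A B :: "'a :: comm_semiring_1 mat"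
  assumes "similar_mat_wit A B P Q"
  shows "mat_trace A = mat_trace B"
proof -
  define n where "n = dim_row A"
  from similar_mat_witD[OF n_def assms] have
    carr: "B \<in> carrier_mat n n" "P \<in> carrier_mat n n" "Q \<in> carrier_mat n n"
    and QP: "Q * P = 1\<^sub>m n" and A: "A = P * B * Q" by auto
  have "mat_trace A = mat_trace (P * (B * Q))"
    using carr A by (simp add: assoc_mult_mat[of _ n n _ n _ n])
  also have "\<dots> = mat_trace ((B * Q) * P)"
    using carr by (intro mat_trace_mult_comm[of _ n]) auto
  also have "(B * Q) * P = B"
    using carr QP by (simp add: assoc_mult_mat[of _ n n _ n _ n])
  finally show ?thesis .
qed

text \<open>A term with inner index \<open>k\<close> in entry \<open>(i, j)\<close> vanishes unless
  i <= k <= j, so below the diagonal nothing survives and on it only \<open>k = i\<close>.\<close>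

lemma upper_triangular_mult:
  fixes A B :: "'a :: semiring_0 mat"
  assumes A: "A \<in> carrier_mat n n" "upper_triangular A"
    and B: "B \<in> carrier_mat n n" "upper_triangular B"
  shows "upper_triangular (A * B)"
    and "i < n \<Longrightarrow> (A * B) $$ (i, i) = A $$ (i, i) * B $$ (i, i)"
proof -
  have entry: "(A * B) $$ (i, j) = (\<Sum>k<n. A $$ (i, k) * B $$ (k, j))"
    if "i < n" "j < n" for i j
    using A(1) B(1) that by (simp add: scalar_prod_def atLeast0LessThan)
  have zero: "A $$ (i, k) * B $$ (k, j) = 0" if "i < n" "k < n" "k < i \<or> j < k" for i j k
    using that A B by (auto dest: upper_triangularD)
  show "upper_triangular (A * B)"
  proof
    fix i j assume "j < i" "i < dim_row (A * B)"
    then have "i < n" "j < n" "j < i" using A(1) by auto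
    then show "(A * B) $$ (i, j) = 0"
      by (subst entry) (auto intro!: sum.neutral zero)
  qed
  show "(A * B) $$ (i, i) = A $$ (i, i) * B $$ (i, i)" if i: "i < n"
  proof -
    have "(A * B) $$ (i, i) = (\<Sum>k\<in>{i}. A $$ (i, k) * B $$ (k, i))"
      unfolding entry[OF i i] using i
      by (intro sum.mono_neutral_right) (auto intro!: zero simp: neq_iff)
    then show ?thesis by simp
  qed
qed

lemma upper_triangular_pow:
  fixes A :: "'a :: semiring_1 mat"
  assumes A: "A \<in> carrier_mat n n" "upper_triangular A"
  shows "upper_triangular (A ^\<^sub>m k) \<and> (\<forall>i<n. (A ^\<^sub>m k) $$ (i, i) = A $$ (i, i) ^ k)"
proof (induction k)
  case 0
  then show ?case using A by auto
next
  case (Suc k)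
  then show ?case
    using upper_triangular_mult[OF pow_carrier_mat[OF A(1)] _ A, of k]
    by (auto simp: power_commutes)
qed

text \<open>Schur decomposition makes \<open>A\<close> similar to a triangular matrix, whose powers
  carry the powers of the eigenvalues on the diagonal. The list \<open>es\<close> keeps the
  algebraic multiplicities, which the set \<open>spectrum A\<close> forgets.\<close>

lemma mat_trace_pow_eigenvalues:
  fixes A :: "complex mat"
  assumes A: "A \<in> carrier_mat n n"
  obtains es where "set es = spectrum A" "\<And>k. mat_trace (A ^\<^sub>m k) = (\<Sum>e\<leftarrow>es. e ^ k)"
proof -
  obtain es where es: "char_poly A = (\<Prod>e\<leftarrow>es. [:- e, 1:])"
    using char_poly_factorized[OF A] by blast
  obtain B P Q where "schur_decomposition A es = (B, P, Q)"
    by (cases "schur_decomposition A es")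
  from schur_decomposition[OF A es this]
  have wit: "similar_mat_wit A B P Q" and B: "upper_triangular B" and diag: "diag_mat B = es"
    by auto
  have carr: "B \<in> carrier_mat n n" using similar_mat_witD2[OF A wit] by auto
  have "mat_trace (A ^\<^sub>m k) = (\<Sum>e\<leftarrow>es. e ^ k)" for k
  proof -
    have "mat_trace (A ^\<^sub>m k) = mat_trace (B ^\<^sub>m k)"
      by (rule mat_trace_similar[OF similar_mat_wit_pow[OF wit]])
    also have "\<dots> = (\<Sum>i<n. B $$ (i, i) ^ k)"
      using carr upper_triangular_pow[OF carr B, of k] by (simp add: mat_trace_def)
    also have "\<dots> = (\<Sum>e\<leftarrow>es. e ^ k)"
      using carr unfolding diag[symmetric] diag_mat_def
      by (simp add: comp_def interv_sum_list_conv_sum_set_nat atLeast0LessThan)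
    finally show ?thesis .
  qed
  moreover have "set es = spectrum A"
    unfolding spectrum_root_char_poly[OF A] es by (auto simp: poly_prod_list prod_list_zero_iff)
  ultimately show ?thesis using that by blast
qed

text \<open>The characteristic polynomial is monic with integer coefficients.\<close>

lemma algebraic_int_eigenvalue:
  fixes A :: "int mat"
  assumes A: "A \<in> carrier_mat n n" and ev: "eigenvalue (map_mat of_int A :: complex mat) x"
  shows "algebraic_int x"
  unfolding algebraic_int_altdef_ipoly
proof (intro exI conjI)
  show "poly (map_poly of_int (char_poly A)) x = 0"
    using ev A unfolding of_int_hom.char_poly_hom[OF A, symmetric]
    by (subst (asm) eigenvalue_root_char_poly[of _ n]) auto
  show "lead_coeff (char_poly A) = 1"
    using degree_monic_char_poly[OF A] by auto
qed

lemma mat_trace_of_int: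
  assumes "A \<in> carrier_mat n n"
  shows "mat_trace (map_mat of_int A) = of_int (mat_trace A)"
  using assms by (simp add: mat_trace_def)

lemma sum_list_map_two_values:
  fixes f :: "'a \<Rightarrow> 'b :: comm_semiring_1"
  assumes "a \<noteq> b" "set xs \<subseteq> {a, b}"
  shows "(\<Sum>x\<leftarrow>xs. f x) = of_nat (count_list xs a) * f a + of_nat (count_list xs b) * f b"
  using assms(2) by (induction xs) (use assms(1) in \<open>auto simp: algebra_simps\<close>)

text \<open>The first three power sums suffice: the first one makes \<open>b\<close> a rational
  multiple of \<open>a\<close>, the second makes the square of \<open>a\<close> rational, and the
  third makes \<open>a\<close> itself rational unless \<open>k = m\<close>. Integrality then turns
  rational numbers into integers.\<close>

lemma two_eigenvalues_of_traceless_int_mat: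
  fixes A :: "int mat"
  assumes A: "A \<in> carrier_mat n n" and tr: "mat_trace A = 0"
    and spec: "spectrum (map_mat of_int A :: complex mat) = {a, b}" and ab: "a \<noteq> b"
  obtains i j where "a = of_int i" "b = of_int j" "i \<noteq> 0" "j \<noteq> 0"
  | N where "b = - a" "a\<^sup>2 = of_int N" "N \<noteq> 0"
proof -
  let ?A = "map_mat of_int A :: complex mat"
  have A': "?A \<in> carrier_mat n n" using A by simp
  obtain es where es: "set es = {a, b}" and tres: "\<And>k. mat_trace (?A ^\<^sub>m k) = (\<Sum>e\<leftarrow>es. e ^ k)"
    using mat_trace_pow_eigenvalues[OF A'] spec by metis
  have pow: "?A ^\<^sub>m l = map_mat of_int (A ^\<^sub>m l)" for l
    by (rule of_int_hom.mat_hom_pow[OF A, symmetric])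
  define k m where "k = count_list es a" and "m = count_list es b"
  have k: "k > 0" and m: "m > 0"
    using es by (auto simp: k_def m_def count_list_0_iff simp flip: neq0_conv)
  have sums: "(\<Sum>e\<leftarrow>es. f e) = of_nat k * f a + of_nat m * f b" for f :: "complex \<Rightarrow> complex"
    unfolding k_def m_def using es by (intro sum_list_map_two_values[OF ab]) simp
  have power_sum: "of_nat k * a ^ l + of_nat m * b ^ l = of_int (mat_trace (A ^\<^sub>m l))" for l
    using tres[of l] sums[of "\<lambda>e. e ^ l"] unfolding pow
    by (simp add: mat_trace_of_int[OF pow_carrier_mat[OF A]])
  have lin: "of_nat k * a + of_nat m * b = 0"
    using power_sum[of 1] tr A by simp
  \<comment> \<open>If one of the two were zero, this relation would force the other to be zero as
    well.\<close>
  have ne: "a \<noteq> 0" "b \<noteq> 0" using lin k m ab by auto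
  define q :: complex where "q = of_nat k / of_nat m"
  have q: "q \<in> \<rat>" by (simp add: q_def)
  have b: "b = - q * a" using lin m by (simp add: q_def field_simps add_eq_0_iff)
  have int: "of_nat k * a ^ l + of_nat m * b ^ l \<in> \<rat>" for l
    unfolding power_sum by simp
  \<comment> \<open>Squares are treated too, as eigenvalues of \<open>A ^\<^sub>m 2\<close>: when
    \<open>a\<close> is irrational, integrality is needed for its square.\<close>
  have alg: "algebraic_int e" "algebraic_int (e\<^sup>2)" if "e \<in> {a, b}" for e
  proof -
    have ev: "eigenvalue ?A e" using that spec by (auto simp: spectrum_def)
    then show "algebraic_int e" by (rule algebraic_int_eigenvalue[OF A])
    from ev obtain v where v: "eigenvector ?A v e" by (auto simp: eigenvalue_def)
    have "eigenvector (?A ^\<^sub>m 2) v (e\<^sup>2)"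
      using eigenvector_pow[OF A' v, of 2] v A by (auto simp: eigenvector_def)
    then show "algebraic_int (e\<^sup>2)"
      using algebraic_int_eigenvalue[OF pow_carrier_mat[OF A, of 2]] unfolding pow eigenvalue_def
      by blast
  qed
  have "a\<^sup>2 * (of_nat k + of_nat m * q\<^sup>2) \<in> \<rat>"
    using int[of 2] by (simp add: b algebra_simps power2_eq_square)
  \<comment> \<open>The closed form \<open>k (m + k) / m\<close> shows that the factor is nonzero
    and can be divided out.\<close>
  moreover have "of_nat k + of_nat m * q\<^sup>2 = (of_nat (k * m + k\<^sup>2) / of_nat m :: complex)"
    using m by (simp add: q_def field_simps power2_eq_square)
  moreover have "(of_nat (k * m + k\<^sup>2) / of_nat m :: complex) \<noteq> 0"
    using k m by (simp only: divide_eq_0_iff of_nat_eq_0_iff) simp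
  ultimately have sq: "a\<^sup>2 \<in> \<rat>"
    by (metis Rats_divide Rats_of_nat nonzero_mult_div_cancel_right)
  show ?thesis
  proof (cases "k = m")
    case True
    then have "b = - a" using b m by (simp add: q_def)
    moreover obtain N where "a\<^sup>2 = of_int N"
      using rational_algebraic_int_is_int[OF alg(2) sq] by (auto elim: Ints_cases)
    ultimately show ?thesis using that(2) ne(1) by (metis of_int_0 zero_eq_power2)
  next
    case False
    \<comment> \<open>In the cubic relation the cofactor vanishes only for \<open>k = m\<close>, the
      case already settled; dividing by it shows that \<open>a\<close> is rational.\<close>
    have "a * (a\<^sup>2 * (of_nat k - of_nat m * q ^ 3)) \<in> \<rat>"
      using int[of 3] by (simp add: b algebra_simps power2_eq_square power3_eq_cube)
    moreover have "of_nat k - of_nat m * q ^ 3 =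
        (of_nat k * (of_nat m - of_nat k) * (of_nat m + of_nat k) / (of_nat m)\<^sup>2 :: complex)"
      using m by (simp add: q_def field_simps power2_eq_square power3_eq_cube)
    moreover have "of_nat k * (of_nat m - of_nat k) * (of_nat m + of_nat k) / (of_nat m)\<^sup>2 \<noteq> (0 :: complex)"
      using k m False by (simp flip: of_nat_add)
    moreover have "a\<^sup>2 * (of_nat k - of_nat m * q ^ 3) \<in> \<rat>"
      using sq q by simp
    ultimately have a: "a \<in> \<rat>"
      by (metis Rats_divide mult_eq_0_iff ne(1) nonzero_mult_div_cancel_right power_not_zero)
    then have "b \<in> \<rat>" using b q by simp
    then show ?thesis
      using a that(1) ne rational_algebraic_int_is_int[OF alg(1)]
      by (metis Ints_cases insertCI of_int_0)
  qed
qed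

subsection \<open>Eigenvectors of coronas\<close>

text \<open>Complex functions on the vertices replace vectors, which keeps the arguments about
  coronas free of enumerations; \<open>adj_spectrum_iff_eigenfun\<close> links the two
  views.\<close>

definition adj :: "('a, 'm) sgraph_scheme \<Rightarrow> 'a \<Rightarrow> 'a \<Rightarrow> complex" where
  "adj S v w = (if {v, w} \<in> edges S then of_int (sign S {v, w}) else 0)"

lemma adj_commute: "adj S v w = adj S w v"
  by (simp add: adj_def insert_commute)

definition adj_app :: "('a, 'm) sgraph_scheme \<Rightarrow> ('a \<Rightarrow> complex) \<Rightarrow> 'a \<Rightarrow> complex" where
  "adj_app S x v = (\<Sum>w\<in>verts S. adj S v w * x w)"

lemma adj_app_cong:
  "(\<And>w. w \<in> verts S \<Longrightarrow> x w = y w) \<Longrightarrow> adj_app S x v = adj_app S y v"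
  by (simp add: adj_app_def)

lemma adj_app_scale: "adj_app S (\<lambda>w. c * x w) v = c * adj_app S x v"
  by (simp add: adj_app_def sum_distrib_left algebra_simps)

lemma adj_app_diff: "adj_app S (\<lambda>w. x w - y w) v = adj_app S x v - adj_app S y v"
  by (simp add: adj_app_def sum_subtractf algebra_simps)

lemma adj_app_zero: "(\<And>w. w \<in> verts S \<Longrightarrow> x w = 0) \<Longrightarrow> adj_app S x v = 0"
  by (simp add: adj_app_def)

text \<open>The operator is symmetric and can be moved onto the constant function 1. This is how the
  row sums of \<open>T\<close> enter.\<close>

lemma sum_adj_app:
  "(\<Sum>u\<in>verts S. adj_app S x u) = (\<Sum>w\<in>verts S. adj_app S (\<lambda>_. 1) w * x w)"
  unfolding adj_app_def sum_distrib_right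
  by (subst sum.swap) (simp add: adj_commute)

text \<open>A nonzero value is demanded at a vertex because values outside \<open>verts S\<close>
  are arbitrary.\<close>

definition eigenfun :: "('a, 'm) sgraph_scheme \<Rightarrow> complex \<Rightarrow> ('a \<Rightarrow> complex) \<Rightarrow> bool" where
  "eigenfun S \<mu> x \<longleftrightarrow> (\<exists>v\<in>verts S. x v \<noteq> 0) \<and> (\<forall>v\<in>verts S. adj_app S x v = \<mu> * x v)"

lemma adj_spectrum_iff_eigenfun:
  assumes vs: "vertex_enum S vs"
  shows "\<mu> \<in> adj_spectrum S vs \<longleftrightarrow> (\<exists>x. eigenfun S \<mu> x)"
proof -
  let ?n = "length vs"
  let ?A = "map_mat of_int (adj_matrix S vs) :: complex mat"
  have dist: "distinct vs" and verts: "verts S = set vs"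
    using vs by (auto simp: vertex_enum_def)
  have A: "?A \<in> carrier_mat ?n ?n" by (simp add: adj_matrix_def)
  have sums: "sum g (verts S) = (\<Sum>j<?n. g (vs ! j))" for g :: "'a \<Rightarrow> complex"
    unfolding verts by (rule sum.reindex_bij_betw[symmetric, OF bij_betw_nth[OF dist refl refl]])
  have app: "(?A *\<^sub>v v) $ i = adj_app S x (vs ! i)"
    if "v \<in> carrier_vec ?n" "i < ?n" "\<And>j. j < ?n \<Longrightarrow> v $ j = x (vs ! j)" for v x i
    using that
    by (auto simp: adj_matrix_def scalar_prod_def adj_app_def sums adj_def atLeast0LessThan
        intro!: sum.cong)
  show ?thesis
  proof
    assume "\<mu> \<in> adj_spectrum S vs"
    then obtain v where v: "v \<in> carrier_vec ?n" "v \<noteq> 0\<^sub>v ?n" "?A *\<^sub>v v = \<mu> \<cdot>\<^sub>v v"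
      using A by (auto simp: adj_spectrum_def spectrum_def eigenvalue_def eigenvector_def)
    \<comment> \<open>Inverts the enumeration: \<open>distinct vs\<close> makes the index unique,
      and the values away from the vertices do not matter.\<close>
    define x where "x w = v $ (THE j. j < ?n \<and> vs ! j = w)" for w
    have x: "x (vs ! j) = v $ j" if "j < ?n" for j
    proof -
      have "(THE i. i < ?n \<and> vs ! i = vs ! j) = j"
        using that dist by (auto simp: nth_eq_iff_index_eq intro!: the_equality)
      then show ?thesis by (simp add: x_def)
    qed
    obtain i where "i < ?n" "v $ i \<noteq> 0"
      using v(1,2) by (metis carrier_vecD eq_vecI index_zero_vec)
    then have "\<exists>w\<in>verts S. x w \<noteq> 0" using x verts by (metis nth_mem)
    moreover have "adj_app S x (vs ! i) = \<mu> * x (vs ! i)" if "i < ?n" for i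
      using app[OF v(1) that, of x] x v that by simp
    ultimately show "\<exists>x. eigenfun S \<mu> x"
      unfolding eigenfun_def verts by (metis in_set_conv_nth)
  next
    assume "\<exists>x. eigenfun S \<mu> x"
    then obtain x where x: "\<exists>i<?n. x (vs ! i) \<noteq> 0"
      "\<And>i. i < ?n \<Longrightarrow> adj_app S x (vs ! i) = \<mu> * x (vs ! i)"
      unfolding eigenfun_def verts by (metis in_set_conv_nth)
    define v where "v = vec ?n (\<lambda>i. x (vs ! i))"
    have v: "v \<in> carrier_vec ?n" by (simp add: v_def)
    have "?A *\<^sub>v v = \<mu> \<cdot>\<^sub>v v"
    proof (rule eq_vecI)
      fix i assume "i < dim_vec (\<mu> \<cdot>\<^sub>v v)"
      then have i: "i < ?n" by (simp add: v_def)
      then show "(?A *\<^sub>v v) $ i = (\<mu> \<cdot>\<^sub>v v) $ i"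
        by (subst app[OF v, of i x]) (auto simp: v_def x)
    qed (use A in \<open>simp add: v_def\<close>)
    moreover have "v \<noteq> 0\<^sub>v ?n" using x(1) by (auto simp: v_def vec_eq_iff)
    ultimately show "\<mu> \<in> adj_spectrum S vs"
      using v A by (auto simp: adj_spectrum_def spectrum_def eigenvalue_def eigenvector_def)
  qed
qed

section \<open>The adjacency operator of a corona\<close>

lemma sum_verts_s_corona:
  assumes "finite (verts S)" "finite (verts T)"
  shows "sum g (verts (S \<star>\<^sub>s T)) =
    (\<Sum>v\<in>verts S. g (Inl v)) + (\<Sum>i\<in>verts S. \<Sum>u\<in>verts T. g (Inr (i, u)))"
  using assms unfolding s_corona_def
  by (simp, subst sum.union_disjoint)
     (auto simp: sum.reindex comp_def sum.cartesian_product intro!: sum.cong)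

lemma adj_s_corona_Inl: "adj (S \<star>\<^sub>s T) (Inl v) (Inl w) = adj S v w"
  unfolding adj_def sign_s_corona
  by (auto simp: s_corona_def doubleton_eq_iff insert_commute)

lemma adj_s_corona_Inl_Inr:
  assumes "u \<in> verts T"
  shows "adj (S \<star>\<^sub>s T) (Inl h) (Inr (i, u)) = adj S h i"
  unfolding adj_def sign_s_corona
  using assms by (auto simp: s_corona_def doubleton_eq_iff)

lemma adj_s_corona_Inr:
  assumes "i \<in> verts S"
  shows "adj (S \<star>\<^sub>s T) (Inr (i, u)) (Inr (j, w)) = (if i = j then adj T u w else 0)"
proof (cases "i = j")
  case True
  then show ?thesis
    using assms unfolding adj_def True sign_s_corona
    by (auto simp: s_corona_def doubleton_eq_iff insert_commute)
next
  case False
  then show ?thesis by (auto simp: adj_def s_corona_def doubleton_eq_iff)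
qed

text \<open>A vertex of \<open>S\<close> sees the copies of \<open>T\<close> only through the sums
  over them, which reduces the eigenvalue problem to functions on \<open>S\<close>.\<close>

lemma adj_app_s_corona_Inl:
  assumes "finite (verts S)" "finite (verts T)"
  shows "adj_app (S \<star>\<^sub>s T) x (Inl h) =
    adj_app S (\<lambda>v. x (Inl v)) h + adj_app S (\<lambda>i. \<Sum>u\<in>verts T. x (Inr (i, u))) h"
  unfolding adj_app_def sum_verts_s_corona[OF assms]
  by (simp add: adj_s_corona_Inl adj_s_corona_Inl_Inr sum_distrib_left)

text \<open>Distinct copies are not joined, and all vertices of copy \<open>i\<close> have the same
  neighbours in \<open>S\<close> as \<open>i\<close>, with the same signs.\<close>

lemma adj_app_s_corona_Inr:
  assumes "finite (verts S)" "finite (verts T)" and i: "i \<in> verts S" and u: "u \<in> verts T"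
  shows "adj_app (S \<star>\<^sub>s T) x (Inr (i, u)) =
    adj_app S (\<lambda>v. x (Inl v)) i + adj_app T (\<lambda>w. x (Inr (i, w))) u"
proof -
  have "adj (S \<star>\<^sub>s T) (Inr (i, u)) (Inl v) = adj S i v" for v
    using adj_s_corona_Inl_Inr[OF u, of S v i] by (simp add: adj_commute)
  moreover have "(\<Sum>j\<in>verts S. \<Sum>w\<in>verts T. adj (S \<star>\<^sub>s T) (Inr (i, u)) (Inr (j, w)) * x (Inr (j, w)))
      = (\<Sum>j\<in>verts S. if i = j then adj_app T (\<lambda>w. x (Inr (j, w))) u else 0)"
    by (intro sum.cong) (simp_all add: adj_s_corona_Inr[OF i] adj_app_def)
  ultimately show ?thesis
    unfolding adj_app_def sum_verts_s_corona[OF assms(1,2)] using assms(1) i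
    by (simp add: adj_app_def)
qed

text \<open>Factor the polynomial over the complex numbers: if the inner factor annihilates the vector,
  its root is an eigenvalue, and otherwise the image under the inner factor is an eigenvector.\<close>

lemma quadratic_annihilator_eigenfun:
  assumes "p \<noteq> 0" and ex: "\<exists>v\<in>verts S. x v \<noteq> 0"
    and eq: "\<And>v. v \<in> verts S \<Longrightarrow> p * adj_app S (adj_app S x) v + q * adj_app S x v + r * x v = 0"
  obtains \<theta> y where "eigenfun S \<theta> y" "p * \<theta>\<^sup>2 + q * \<theta> + r = 0"
proof -
  define D where "D = csqrt (q\<^sup>2 - 4 * p * r)"
  define c d where "c = (- q + D) / (2 * p)" and "d = (- q - D) / (2 * p)"
  have D2: "D\<^sup>2 = q\<^sup>2 - 4 * p * r" by (simp add: D_def)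
  have "c * d = (q\<^sup>2 - D\<^sup>2) / (4 * p\<^sup>2)"
    by (simp add: c_def d_def field_simps power2_eq_square)
  then have cd: "c + d = - q / p" "c * d = r / p"
    using \<open>p \<noteq> 0\<close> unfolding D2 by (auto simp: c_def d_def field_simps power2_eq_square)
  have fact: "p * z\<^sup>2 + q * z + r = p * (z - c) * (z - d)" for z
  proof -
    have "p * (z - c) * (z - d) = p * z\<^sup>2 - p * (c + d) * z + p * (c * d)"
      by (simp add: algebra_simps power2_eq_square)
    then show ?thesis unfolding cd using \<open>p \<noteq> 0\<close> by simp
  qed
  show ?thesis
  proof (cases "\<forall>v\<in>verts S. adj_app S x v = d * x v")
    case True
    with ex have "eigenfun S d x" by (auto simp: eigenfun_def)
    then show ?thesis using that[OF _ trans[OF fact[of d]]] by simp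
  next
    case False
    have "adj_app S (\<lambda>w. adj_app S x w - d * x w) v = c * (adj_app S x v - d * x v)"
      if "v \<in> verts S" for v
    proof -
      have "p * (adj_app S (adj_app S x) v - (c + d) * adj_app S x v + c * d * x v) = 0"
        unfolding cd using eq[OF that] \<open>p \<noteq> 0\<close> by (simp add: algebra_simps)
      then have "adj_app S (adj_app S x) v - (c + d) * adj_app S x v + c * d * x v = 0"
        using \<open>p \<noteq> 0\<close> by (metis mult_eq_0_iff)
      then show ?thesis
        by (simp add: adj_app_diff adj_app_scale algebra_simps)
    qed
    with False have "eigenfun S c (\<lambda>w. adj_app S x w - d * x w)"
      by (auto simp: eigenfun_def)
    then show ?thesis using that[OF _ trans[OF fact[of c]]] by simp
  qed
qed

text \<open>The first set comes from eigenfunctions of \<open>S\<close> extended by a constant on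
  each copy of \<open>T\<close>, the second from functions supported in a single copy with sum zero
  there. Excluding the eigenvalue 0 makes the adjacency operator of \<open>S\<close> injective,
  which separates the two cases.\<close>

theorem adj_spectrum_s_corona:
  assumes S: "signed_graph S" "verts S \<noteq> {}" "vertex_enum S vs" "0 \<notin> adj_spectrum S vs"
    and T: "signed_graph T" "verts T \<noteq> {}" "\<And>u. u \<in> verts T \<Longrightarrow> adj_app T (\<lambda>_. 1) u = s"
    and ws: "vertex_enum (S \<star>\<^sub>s T) ws"
  shows "adj_spectrum (S \<star>\<^sub>s T) ws =
    {\<mu>. \<exists>\<theta>\<in>adj_spectrum S vs. (\<mu> - \<theta>) * (\<mu> - s) = of_nat (card (verts T)) * \<theta>\<^sup>2} \<union>
    {\<mu>. \<exists>y. eigenfun T \<mu> y \<and> (\<Sum>u\<in>verts T. y u) = 0}"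
    (is "_ = ?L \<union> ?R")
proof -
  define n :: complex where "n = of_nat (card (verts T))"
  have fin: "finite (verts S)" "finite (verts T)"
    using S(1) T(1) by (simp_all add: signed_graph_def)
  have n: "n \<noteq> 0" using fin(2) T(2) by (simp add: n_def)
  note app = adj_app_s_corona_Inl[OF fin] adj_app_s_corona_Inr[OF fin]
  note spec = adj_spectrum_iff_eigenfun[OF S(3)]
  have verts: "verts (S \<star>\<^sub>s T) = Inl ` verts S \<union> Inr ` (verts S \<times> verts T)"
    by (simp add: s_corona_def)
  have "\<mu> \<in> ?L \<union> ?R" if x: "eigenfun (S \<star>\<^sub>s T) \<mu> x" for \<mu> x
  proof -
    \<comment> \<open>The part on \<open>S\<close> and the sums over the copies: \<open>eqX\<close>
      and \<open>eqY\<close> form a closed system in these two functions.\<close>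
    define X Y where "X = (\<lambda>v. x (Inl v))" and "Y = (\<lambda>v. \<Sum>u\<in>verts T. x (Inr (v, u)))"
    have eqX: "adj_app S X h + adj_app S Y h = \<mu> * X h" if "h \<in> verts S" for h
      using x that app(1)[of x h] by (auto simp: eigenfun_def verts X_def Y_def)
    have eqI: "adj_app S X i + adj_app T (\<lambda>w. x (Inr (i, w))) u = \<mu> * x (Inr (i, u))"
      if "i \<in> verts S" "u \<in> verts T" for i u
      using x that app(2)[of i u x] by (auto simp: eigenfun_def verts X_def)
    \<comment> \<open>Sum \<open>eqI\<close> over copy \<open>i\<close>; constant row sums turn the
      contribution of \<open>T\<close> into \<open>s * Y i\<close>.\<close>
    have eqY: "n * adj_app S X i = (\<mu> - s) * Y i" if i: "i \<in> verts S" for i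
    proof -
      have "(\<Sum>u\<in>verts T. adj_app S X i + adj_app T (\<lambda>w. x (Inr (i, w))) u) = \<mu> * Y i"
        by (simp add: eqI[OF i] Y_def sum_distrib_left)
      moreover have "(\<Sum>u\<in>verts T. adj_app T (\<lambda>w. x (Inr (i, w))) u) = s * Y i"
        unfolding sum_adj_app by (simp add: T(3) Y_def sum_distrib_left)
      ultimately show ?thesis by (simp add: sum.distrib n_def algebra_simps)
    qed
    have inj: "\<forall>v\<in>verts S. y v = 0" if "\<forall>v\<in>verts S. adj_app S y v = 0" for y
    proof (rule ccontr)
      assume "\<not> (\<forall>v\<in>verts S. y v = 0)"
      then have "eigenfun S 0 y" using that by (simp add: eigenfun_def)
      then show False using S(4) spec[of 0] by blast
    qed
    show ?thesis
    proof (cases "\<forall>v\<in>verts S. X v = 0")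
      \<comment> \<open>Injectivity gives \<open>Y = 0\<close>, and a copy on which \<open>x\<close>
        does not vanish carries the required eigenfunction of \<open>T\<close>.\<close>
      case X0: True
      have "\<forall>v\<in>verts S. Y v = 0"
      proof (rule inj, rule ballI)
        fix v assume v: "v \<in> verts S"
        have "adj_app S X v = 0" using X0 by (intro adj_app_zero) simp
        then show "adj_app S Y v = 0" using eqX[OF v] X0 v by simp
      qed
      moreover obtain i u where iu: "i \<in> verts S" "u \<in> verts T" "x (Inr (i, u)) \<noteq> 0"
      proof -
        obtain z where "z \<in> verts (S \<star>\<^sub>s T)" "x z \<noteq> 0" using x unfolding eigenfun_def by blast
        then show ?thesis using X0 that unfolding verts X_def by blast
      qed
      moreover have "eigenfun T \<mu> (\<lambda>u. x (Inr (i, u)))"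
        unfolding eigenfun_def
      proof (intro conjI ballI)
        show "\<exists>u\<in>verts T. x (Inr (i, u)) \<noteq> 0" using iu by blast
        have "adj_app S X i = 0" using X0 by (intro adj_app_zero) simp
        then show "adj_app T (\<lambda>u. x (Inr (i, u))) w = \<mu> * x (Inr (i, w))" if "w \<in> verts T" for w
          using eqI[OF iu(1) that] by simp
      qed
      ultimately show ?thesis unfolding Y_def by blast
    next
      case False
      \<comment> \<open>Apply the operator to \<open>eqY\<close> and eliminate \<open>Y\<close> by
        \<open>eqX\<close>. At an eigenvalue of \<open>S\<close> this quadratic is the equation
        defining the first set.\<close>
      have "n * adj_app S (adj_app S X) v + (\<mu> - s) * adj_app S X v + (- \<mu> * (\<mu> - s)) * X v = 0"
        if v: "v \<in> verts S" for v
      proof -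
        have "n * adj_app S (adj_app S X) v = adj_app S (\<lambda>w. n * adj_app S X w) v"
          by (simp only: adj_app_scale)
        also have "\<dots> = adj_app S (\<lambda>w. (\<mu> - s) * Y w) v"
          by (intro adj_app_cong eqY)
        also have "\<dots> = (\<mu> - s) * adj_app S Y v"
          by (simp only: adj_app_scale)
        also have "adj_app S Y v = \<mu> * X v - adj_app S X v"
          using eqX[OF v] by (simp add: algebra_simps)
        finally show ?thesis by (simp add: algebra_simps)
      qed
      then obtain \<theta> y where "eigenfun S \<theta> y" "n * \<theta>\<^sup>2 + (\<mu> - s) * \<theta> + (- \<mu> * (\<mu> - s)) = 0"
        using quadratic_annihilator_eigenfun[OF n, of S X "\<mu> - s" "- \<mu> * (\<mu> - s)"] False by blast
      then show ?thesis
        using spec[of \<theta>] unfolding n_def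
          by (intro UnI1 CollectI bexI[of _ \<theta>]) (auto simp: algebra_simps)
    qed
  qed
  moreover have "\<exists>x. eigenfun (S \<star>\<^sub>s T) \<mu> x"
    if \<theta>: "\<theta> \<in> adj_spectrum S vs" and eq: "(\<mu> - \<theta>) * (\<mu> - s) = n * \<theta>\<^sup>2" for \<mu> \<theta>
  proof -
    obtain X where X: "eigenfun S \<theta> X" using \<theta> spec[of \<theta>] by blast
    have "\<theta> \<noteq> 0"
      using \<theta> S(4) by metis
    with eq n have "(\<mu> - \<theta>) * (\<mu> - s) \<noteq> 0" by simp
    then have ms: "\<mu> - s \<noteq> 0" by simp
    \<comment> \<open>This \<open>c\<close> solves the eigenvalue equation on the copies; the
      assumed quadratic relation is then the equation on \<open>S\<close>.\<close>
    define c where "c = \<theta> / (\<mu> - s)"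
    define x where "x = case_sum X (\<lambda>(i, u :: 'b). c * X i)"
    have c: "\<theta> + n * c * \<theta> = \<mu>" "\<theta> + c * s = \<mu> * c"
      using eq ms by (auto simp: c_def field_simps power2_eq_square)
    have "adj_app (S \<star>\<^sub>s T) x (Inl h) = \<mu> * x (Inl h)" if h: "h \<in> verts S" for h
    proof -
      have "adj_app (S \<star>\<^sub>s T) x (Inl h) = adj_app S X h + adj_app S (\<lambda>i. (n * c) * X i) h"
        by (simp add: app x_def n_def mult.assoc)
      also have "\<dots> = (\<theta> + n * c * \<theta>) * X h"
        using X h unfolding adj_app_scale by (simp add: eigenfun_def algebra_simps)
      finally show ?thesis by (simp add: c x_def)
    qed
    moreover have "adj_app (S \<star>\<^sub>s T) x (Inr (i, u)) = \<mu> * x (Inr (i, u))"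
      if i: "i \<in> verts S" and u: "u \<in> verts T" for i u
    proof -
      have "adj_app T (\<lambda>_. c * X i) u = c * X i * s"
        using adj_app_scale[of T "c * X i" "\<lambda>_. 1" u] T(3)[OF u] by simp
      moreover have "adj_app S X i = \<theta> * X i" using X i unfolding eigenfun_def by blast
      moreover have "adj_app (S \<star>\<^sub>s T) x (Inr (i, u)) = adj_app S X i + adj_app T (\<lambda>_. c * X i) u"
        unfolding app(2)[OF i u] x_def by simp
      ultimately have "adj_app (S \<star>\<^sub>s T) x (Inr (i, u)) = (\<theta> + c * s) * X i"
        by (simp only: algebra_simps)
      then show ?thesis by (simp add: c x_def mult.assoc)
    qed
    moreover have "\<exists>z\<in>verts (S \<star>\<^sub>s T). x z \<noteq> 0"
    proof -
      obtain v where "v \<in> verts S" "X v \<noteq> 0" using X unfolding eigenfun_def by blast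
      then show ?thesis by (intro bexI[of _ "Inl v"]) (auto simp: verts x_def)
    qed
    ultimately have "eigenfun (S \<star>\<^sub>s T) \<mu> x" unfolding eigenfun_def verts by blast
    then show ?thesis by blast
  qed
  moreover have "\<exists>x. eigenfun (S \<star>\<^sub>s T) \<mu> x"
    if y: "eigenfun T \<mu> y" and sum: "(\<Sum>u\<in>verts T. y u) = 0" for \<mu> y
  proof -
    obtain i where i: "i \<in> verts S" using S by blast
    \<comment> \<open>Only copy \<open>i\<close> carries values, and as these sum to zero, the
      vertices of \<open>S\<close> do not notice them.\<close>
    define x where "x = case_sum (\<lambda>_ :: 'a. 0) (\<lambda>(j, u). if j = i then y u else 0)"
    have "adj_app (S \<star>\<^sub>s T) x (Inl h) = 0" for h
    proof -
      have "(\<Sum>u\<in>verts T. if j = i then y u else 0) = 0" for j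
        using sum by (cases "j = i") simp_all
      then show ?thesis unfolding app x_def by (simp add: adj_app_zero)
    qed
    moreover have "adj_app (S \<star>\<^sub>s T) x (Inr (j, u)) = \<mu> * x (Inr (j, u))"
      if "j \<in> verts S" "u \<in> verts T" for j u
      using y that by (auto simp: app x_def adj_app_zero eigenfun_def)
    moreover have "\<exists>z\<in>verts (S \<star>\<^sub>s T). x z \<noteq> 0"
    proof -
      obtain u where "u \<in> verts T" "y u \<noteq> 0" using y unfolding eigenfun_def by blast
      then show ?thesis using i by (intro bexI[of _ "Inr (i, u)"]) (auto simp: verts x_def)
    qed
    ultimately have "eigenfun (S \<star>\<^sub>s T) \<mu> x" unfolding eigenfun_def verts by (auto simp: x_def)
    then show ?thesis by blast
  qed
  ultimately show ?thesis
    unfolding set_eq_iff adj_spectrum_iff_eigenfun[OF ws] n_def by blast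
qed

subsection \<open>Counting the eigenvalues\<close>

lemma trace_adj_matrix:
  assumes "signed_graph S"
  shows "mat_trace (adj_matrix S vs) = 0"
proof -
  have "{v, v} \<notin> edges S" for v
    using assms by (auto simp: signed_graph_def)
  then show ?thesis by (simp add: mat_trace_def adj_matrix_def)
qed

lemma card_quadratic_roots:
  fixes p q :: complex
  assumes "p\<^sup>2 \<noteq> 4 * q"
  shows "card {x. x\<^sup>2 - p * x + q = 0} = 2"
proof -
  define D where "D = csqrt (p\<^sup>2 - 4 * q)"
  have D2: "D\<^sup>2 = p\<^sup>2 - 4 * q" by (simp add: D_def)
  then have "D \<noteq> 0" using assms by auto
  have "x\<^sup>2 - p * x + q = (x - (p + D) / 2) * (x - (p - D) / 2)" for x
  proof -
    have "(x - (p + D) / 2) * (x - (p - D) / 2) = x\<^sup>2 - p * x + (p\<^sup>2 - D\<^sup>2) / 4"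
      by (simp add: field_simps power2_eq_square)
    then show ?thesis unfolding D2 by simp
  qed
  then have "{x. x\<^sup>2 - p * x + q = 0} = {(p + D) / 2, (p - D) / 2}" by auto
  then show ?thesis using \<open>D \<noteq> 0\<close> by (auto simp: card_insert_if)
qed

lemma card_2_quadratics_roots:
  fixes p q p' q' :: complex
  assumes "p\<^sup>2 \<noteq> 4 * q" "p'\<^sup>2 \<noteq> 4 * q'"
    and disj: "\<And>x. x\<^sup>2 - p * x + q = 0 \<Longrightarrow> x\<^sup>2 - p' * x + q' = 0 \<Longrightarrow> False"
  shows "card {x. x\<^sup>2 - p * x + q = 0 \<or> x\<^sup>2 - p' * x + q' = 0} = 4"
proof -
  let ?A = "{x. x\<^sup>2 - p * x + q = 0}" and ?B = "{x. x\<^sup>2 - p' * x + q' = 0}"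
  have AB: "card ?A = 2" "card ?B = 2"
    using assms by (simp_all add: card_quadratic_roots)
  have "card (?A \<union> ?B) = card ?A + card ?B"
    using AB disj by (intro card_Un_disjoint) (auto intro: card_ge_0_finite)
  then show ?thesis using AB by (simp add: Collect_disj_eq)
qed

section \<open>Diophantine obstructions\<close>

lemma int_sq_diff_eq_4:
  fixes u v :: int
  assumes "u\<^sup>2 - v\<^sup>2 = 4"
  shows "v = 0"
proof -
  define p q where "p = u - v" and "q = u + v"
  have pq: "p * q = 4" using assms by (simp add: p_def q_def power2_eq_square algebra_simps)
  then have "\<bar>p\<bar> \<le> 4"
    using dvd_imp_le_int[of 4 p] by (metis abs_numeral dvd_triv_left zero_neq_numeral)
  then have "p \<in> {- 4, - 3, - 2, - 1, 0, 1, 2, 3, 4}" by auto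
  \<comment> \<open>The factorisations of 4 are \<open>2 * 2\<close>, \<open>1 * 4\<close> and their
    negatives; a sum of 5 or -5 is odd, whereas \<open>p + q = 2 * u\<close>. Hence
    \<open>p = q\<close>, that is \<open>v = 0\<close>.\<close>
  then have "p = q \<or> p + q = 5 \<or> p + q = - 5" using pq by auto
  moreover have "p + q = 2 * u" "q - p = 2 * v" by (simp_all add: p_def q_def)
  ultimately show ?thesis by presburger
qed

text \<open>A zero would make \<open>i / j\<close> a rational root of the monic polynomial
  \<open>x\<^sup>2 + 3 * x + 1\<close>, hence an integer dividing 1, but neither 1 nor -1 is a
  root.\<close>

lemma int_quadratic_form_disc_5_ne_0:
  fixes i j :: int
  assumes "j \<noteq> 0"
  shows "i\<^sup>2 + 3 * i * j + j\<^sup>2 \<noteq> 0"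
proof
  assume eq: "i\<^sup>2 + 3 * i * j + j\<^sup>2 = 0"
  define x :: real where "x = of_int i / of_int j"
  have "x\<^sup>2 + 3 * x + 1 = of_int (i\<^sup>2 + 3 * i * j + j\<^sup>2) / (of_int j)\<^sup>2"
    using assms by (simp add: x_def field_simps power2_eq_square)
  then have x: "x\<^sup>2 + 3 * x + 1 = 0" unfolding eq by simp
  have "algebraic_int x"
    by (rule algebraic_int.intros[of "[:1, 3, 1:]"])
      (use x in \<open>auto simp: coeff_pCons algebra_simps power2_eq_square split: nat.splits\<close>)
  moreover have "x \<in> \<rat>" by (simp add: x_def)
  ultimately obtain k where "x = of_int k"
    using rational_algebraic_int_is_int by (metis Ints_cases)
  then have "real_of_int (k * (k + 3)) = of_int (- 1)"
    using x by (simp add: algebra_simps power2_eq_square add_eq_0_iff)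
  then have "k * (k + 3) = - 1" by (simp only: of_int_eq_iff)
  then have "k dvd 1" by (metis dvd_minus_iff dvd_triv_left)
  then show False using \<open>k * (k + 3) = - 1\<close> by (auto simp: abs_if split: if_splits)
qed

text \<open>In the case \<open>opposite\<close> the eigenvalues may be irrational; the later
  arguments use only that their common square is a nonzero integer.\<close>

lemma two_adj_eigenvalues:
  assumes S: "signed_graph S" and "card (adj_spectrum S vs) = 2"
  obtains (ints) i j where "adj_spectrum S vs = {of_int i, of_int j}" "i \<noteq> j" "i \<noteq> 0" "j \<noteq> 0"
  | (opposite) a N where "adj_spectrum S vs = {a, - a}" "a\<^sup>2 = of_int N" "N \<noteq> 0"
proof -
  obtain a b where ab: "adj_spectrum S vs = {a, b}" "a \<noteq> b"
    using assms(2) by (auto simp: card_2_iff)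
  have "adj_matrix S vs \<in> carrier_mat (length vs) (length vs)"
    by (simp add: adj_matrix_def)
  from two_eigenvalues_of_traceless_int_mat[OF this trace_adj_matrix[OF S] ab[unfolded adj_spectrum_def]]
  show ?thesis
    by (cases) (use ab ints opposite in auto)
qed

text \<open>The two quadratics have discriminants \<open>5 * a\<^sup>2\<close> and
  \<open>5 * b\<^sup>2\<close>, both nonzero, and \<open>form\<close> rules out a common
  root.\<close>

lemma card_corona_K1_values:
  assumes S: "signed_graph S" and card: "card (adj_spectrum S vs) = 2"
  shows "card {\<mu>. \<exists>\<theta>\<in>adj_spectrum S vs. (\<mu> - \<theta>) * \<mu> = \<theta>\<^sup>2} = 4"
proof -
  obtain a b where spec: "adj_spectrum S vs = {a, b}" and "a \<noteq> 0" "b \<noteq> 0" "a \<noteq> b"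
    and form: "a\<^sup>2 + 3 * a * b + b\<^sup>2 \<noteq> 0"
    using S card
  proof (cases rule: two_adj_eigenvalues)
    case (ints i j)
    have "(of_int i)\<^sup>2 + 3 * of_int i * of_int j + (of_int j)\<^sup>2
        = (of_int (i\<^sup>2 + 3 * i * j + j\<^sup>2) :: complex)" by simp
    then show ?thesis
      using that[OF ints(1)] ints int_quadratic_form_disc_5_ne_0[of j i]
      by (metis of_int_0_eq_iff of_int_eq_iff)
  next
    case (opposite a N)
    then have "a \<noteq> 0" by auto
    then show ?thesis using that[OF opposite(1)] by (simp add: power2_eq_square)
  qed
  have "(\<mu> - \<theta>) * \<mu> = \<theta>\<^sup>2 \<longleftrightarrow> \<mu>\<^sup>2 - \<theta> * \<mu> + (- \<theta>\<^sup>2) = 0" for \<mu> \<theta> :: complex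
    by (auto simp: algebra_simps power2_eq_square)
  then have "{\<mu>. \<exists>\<theta>\<in>adj_spectrum S vs. (\<mu> - \<theta>) * \<mu> = \<theta>\<^sup>2}
      = {\<mu>. \<mu>\<^sup>2 - a * \<mu> + (- a\<^sup>2) = 0 \<or> \<mu>\<^sup>2 - b * \<mu> + (- b\<^sup>2) = 0}"
    unfolding spec by auto
  also have "card \<dots> = 4"
  proof (rule card_2_quadratics_roots)
    have "z\<^sup>2 \<noteq> 4 * - z\<^sup>2" if "z \<noteq> 0" for z :: complex
    proof
      assume "z\<^sup>2 = 4 * - z\<^sup>2"
      then have "5 * z\<^sup>2 = 0" by (simp add: algebra_simps)
      then show False using that by simp
    qed
    then show "a\<^sup>2 \<noteq> 4 * - a\<^sup>2" "b\<^sup>2 \<noteq> 4 * - b\<^sup>2"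
      using \<open>a \<noteq> 0\<close> \<open>b \<noteq> 0\<close> by blast+
  next
    fix x assume x: "x\<^sup>2 - a * x + (- a\<^sup>2) = 0" "x\<^sup>2 - b * x + (- b\<^sup>2) = 0"
    \<comment> \<open>A common root is \<open>- (a + b)\<close>; substituting it back gives a relation that forces the
      ratio of \<open>a\<close> and \<open>b\<close> to be irrational.\<close>
    have "(a - b) * (x + a + b) = (x\<^sup>2 - b * x + (- b\<^sup>2)) - (x\<^sup>2 - a * x + (- a\<^sup>2))"
      by (simp add: algebra_simps power2_eq_square)
    then have "(a - b) * (x + a + b) = 0" unfolding x by simp
    then have "x = - (a + b)" using \<open>a \<noteq> b\<close> by (simp add: add.assoc add_eq_0_iff2)
    with x(1) have "a\<^sup>2 + 3 * a * b + b\<^sup>2 = 0" by (simp add: algebra_simps power2_eq_square)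
    with form show False by contradiction
  qed
  finally show ?thesis .
qed

lemma card_corona_K2_values:
  assumes S: "signed_graph S" and card: "card (adj_spectrum S vs) = 2" and s: "s \<in> {- 1, 1 :: int}"
  shows "card (insert (- of_int s)
    {\<mu>. \<exists>\<theta>\<in>adj_spectrum S vs. (\<mu> - \<theta>) * (\<mu> - of_int s) = 2 * \<theta>\<^sup>2}) = 5"
proof -
  let ?s = "of_int s :: complex"
  have s2: "s\<^sup>2 = 1" "s * s = 1" "s \<noteq> 0" using s by auto
  have s2': "?s\<^sup>2 = 1" using s by auto
  \<comment> \<open>Three kinds of coincidence are excluded: \<open>disc\<close> says that neither
    quadratic has a double root, \<open>form\<close> that the two have no common root, and
    \<open>avoid\<close> that \<open>- s\<close> is a root of neither. The formulas are simplified
    by \<open>s\<^sup>2 = 1\<close>.\<close>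
  obtain a b where spec: "adj_spectrum S vs = {a, b}" and "a \<noteq> b"
    and disc: "9 * a\<^sup>2 - 2 * ?s * a + 1 \<noteq> 0" "9 * b\<^sup>2 - 2 * ?s * b + 1 \<noteq> 0"
    and form: "a * b \<noteq> (a + b) * (?s - 2 * (a + b))"
    and avoid: "a\<^sup>2 - ?s * a - 1 \<noteq> 0" "b\<^sup>2 - ?s * b - 1 \<noteq> 0"
    using S card
  proof (cases rule: two_adj_eigenvalues)
    case (ints i j)
    have disc: "9 * k\<^sup>2 - 2 * s * k + 1 \<noteq> 0" for k :: int
    proof
      assume "9 * k\<^sup>2 - 2 * s * k + 1 = 0"
      moreover have "9 * k\<^sup>2 - 2 * s * k + 1 = 8 * k\<^sup>2 + (k - s)\<^sup>2"
        using s2 by (simp add: power2_eq_square algebra_simps)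
      ultimately have "k = 0 \<and> k - s = 0"
        by (smt (verit) zero_le_power2 zero_eq_power2)
      then show False using s2 by simp
    qed
    \<comment> \<open>Integers with product 1 are equal, so \<open>k = k - s\<close>, although
      \<open>s\<close> is nonzero.\<close>
    have avoid: "k\<^sup>2 - s * k - 1 \<noteq> 0" for k :: int
    proof
      assume "k\<^sup>2 - s * k - 1 = 0"
      then have "k * (k - s) = 1" by (simp add: power2_eq_square algebra_simps)
      then show False using s by (auto simp: zmult_eq_1_iff)
    qed
    have form: "i * j \<noteq> (i + j) * (s - 2 * (i + j))"
    proof
      assume "i * j = (i + j) * (s - 2 * (i + j))"
      \<comment> \<open>Complete the square in \<open>i + j\<close> after inserting this into
        \<open>(i - j)\<^sup>2 = (i + j)\<^sup>2 - 4 i j\<close>.\<close>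
      moreover have "(9 * (i + j) - 2 * s)\<^sup>2 - (3 * (i - j))\<^sup>2 =
          4 * s\<^sup>2 + 36 * (i * j - (i + j) * (s - 2 * (i + j)))"
        by (simp add: algebra_simps power2_eq_square)
      ultimately have "(9 * (i + j) - 2 * s)\<^sup>2 - (3 * (i - j))\<^sup>2 = 4"
        using s2(1) by simp
      then have "3 * (i - j) = 0" by (rule int_sq_diff_eq_4)
      then show False using ints by simp
    qed
    have cast: "9 * (of_int k)\<^sup>2 - 2 * ?s * of_int k + 1 = of_int (9 * k\<^sup>2 - 2 * s * k + 1)"
      "(of_int k)\<^sup>2 - ?s * of_int k - 1 = of_int (k\<^sup>2 - s * k - 1)" for k
      by simp_all
    have cast': "of_int i * of_int j = (of_int (i * j) :: complex)"
      "(of_int i + of_int j) * (?s - 2 * (of_int i + of_int j)) = of_int ((i + j) * (s - 2 * (i + j)))"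
      by simp_all
    show ?thesis
      by (rule that[OF ints(1)]; unfold cast cast' of_int_eq_0_iff of_int_eq_iff; fact)
  next
    case (opposite a N)
    have a: "a \<noteq> 0" using opposite by auto
    \<comment> \<open>As \<open>z\<close> may be irrational, its linear term is isolated and
      squared. What remains is an integer equation in \<open>N\<close>, written as a vanishing sum
      of squares that forces \<open>N = 0\<close>.\<close>
    have disc: "9 * z\<^sup>2 - 2 * ?s * z + 1 \<noteq> 0" if z: "z\<^sup>2 = of_int N" for z
    proof
      assume "9 * z\<^sup>2 - 2 * ?s * z + 1 = 0"
      then have "9 * z\<^sup>2 + 1 = 2 * ?s * z" by (simp add: algebra_simps)
      then have "(9 * z\<^sup>2 + 1)\<^sup>2 = 4 * z\<^sup>2" using s2' by (simp only: power_mult_distrib) simp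
      then have "of_int ((9 * N + 1)\<^sup>2) = (of_int (4 * N) :: complex)" unfolding z by simp
      then have "(9 * N + 1)\<^sup>2 = 4 * N" by (simp only: of_int_eq_iff)
      then have "(7 * N + 1)\<^sup>2 + 32 * N\<^sup>2 = 0"
        by (simp add: algebra_simps power2_eq_square)
      then show False using opposite(3)
        by (smt (verit) zero_le_power2 zero_eq_power2)
    qed
    \<comment> \<open>Squaring again leaves an equation in \<open>N\<close> alone; \<open>N\<close>
      and \<open>3 - N\<close> would be equal integers, yet their sum is odd.\<close>
    have avoid: "z\<^sup>2 - ?s * z - 1 \<noteq> 0" if z: "z\<^sup>2 = of_int N" for z
    proof
      assume "z\<^sup>2 - ?s * z - 1 = 0"
      then have "z\<^sup>2 - 1 = ?s * z" by (simp add: algebra_simps)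
      then have "(z\<^sup>2 - 1)\<^sup>2 = z\<^sup>2" using s2' by (simp only: power_mult_distrib) simp
      then have "of_int ((N - 1)\<^sup>2) = (of_int N :: complex)" unfolding z by simp
      then have "(N - 1)\<^sup>2 = N" by (simp only: of_int_eq_iff)
      then have "N * (3 - N) = 1"
        by (simp add: algebra_simps power2_eq_square)
      then show False by (auto simp: zmult_eq_1_iff)
    qed
    \<comment> \<open>For \<open>b = - a\<close> the right side of \<open>form\<close> is zero and
      the left side is \<open>- a\<^sup>2\<close>.\<close>
    show ?thesis
      using a opposite disc[of a] disc[of "- a"] avoid[of a] avoid[of "- a"]
      by (intro that[OF opposite(1)]) auto
  qed
  let ?M = "{\<mu>. \<exists>\<theta>\<in>adj_spectrum S vs. (\<mu> - \<theta>) * (\<mu> - ?s) = 2 * \<theta>\<^sup>2}"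
  have "(\<mu> - \<theta>) * (\<mu> - ?s) = 2 * \<theta>\<^sup>2 \<longleftrightarrow> \<mu>\<^sup>2 - (\<theta> + ?s) * \<mu> + (?s * \<theta> - 2 * \<theta>\<^sup>2) = 0" for \<mu> \<theta>
    by (auto simp: algebra_simps power2_eq_square)
  then have M: "?M = {\<mu>. \<mu>\<^sup>2 - (a + ?s) * \<mu> + (?s * a - 2 * a\<^sup>2) = 0
      \<or> \<mu>\<^sup>2 - (b + ?s) * \<mu> + (?s * b - 2 * b\<^sup>2) = 0}"
    unfolding spec by auto
  have card_M: "card ?M = 4"
    unfolding M
  proof (rule card_2_quadratics_roots)
    show "(a + ?s)\<^sup>2 \<noteq> 4 * (?s * a - 2 * a\<^sup>2)"
    proof
      assume "(a + ?s)\<^sup>2 = 4 * (?s * a - 2 * a\<^sup>2)"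
      moreover have "9 * a\<^sup>2 - 2 * ?s * a + 1 =
          (a + ?s)\<^sup>2 - 4 * (?s * a - 2 * a\<^sup>2) + (1 - ?s\<^sup>2)"
        by (simp add: algebra_simps power2_eq_square)
      ultimately have "9 * a\<^sup>2 - 2 * ?s * a + 1 = 0" using s2' by simp
      with disc show False by blast
    qed
    show "(b + ?s)\<^sup>2 \<noteq> 4 * (?s * b - 2 * b\<^sup>2)"
    proof
      assume "(b + ?s)\<^sup>2 = 4 * (?s * b - 2 * b\<^sup>2)"
      moreover have "9 * b\<^sup>2 - 2 * ?s * b + 1 =
          (b + ?s)\<^sup>2 - 4 * (?s * b - 2 * b\<^sup>2) + (1 - ?s\<^sup>2)"
        by (simp add: algebra_simps power2_eq_square)
      ultimately have "9 * b\<^sup>2 - 2 * ?s * b + 1 = 0" using s2' by simp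
      with disc show False by blast
    qed
  next
    fix x
    assume x: "x\<^sup>2 - (a + ?s) * x + (?s * a - 2 * a\<^sup>2) = 0"
      "x\<^sup>2 - (b + ?s) * x + (?s * b - 2 * b\<^sup>2) = 0"
    \<comment> \<open>The difference of the quadratics is linear in \<open>x\<close> and leaves one
      candidate for a common root; inserting it contradicts \<open>form\<close>.\<close>
    have "(a - b) * (x - (?s - 2 * (a + b))) = (x\<^sup>2 - (b + ?s) * x + (?s * b - 2 * b\<^sup>2))
        - (x\<^sup>2 - (a + ?s) * x + (?s * a - 2 * a\<^sup>2))"
      by (simp add: algebra_simps power2_eq_square)
    then have "(a - b) * (x - (?s - 2 * (a + b))) = 0" unfolding x by simp
    then have "x = ?s - 2 * (a + b)" using \<open>a \<noteq> b\<close> by simp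
    with x(1) have "2 * (a * b) = 2 * ((a + b) * (?s - 2 * (a + b)))"
      by (simp add: algebra_simps power2_eq_square)
    then have "a * b = (a + b) * (?s - 2 * (a + b))" by (subst (asm) mult_left_cancel) simp_all
    with form show False by contradiction
  qed
  have "- ?s \<notin> ?M"
  proof
    assume "- ?s \<in> ?M"
    then obtain z where z: "z = a \<or> z = b" and z2: "(- ?s - z) * (- ?s - ?s) = 2 * z\<^sup>2"
      unfolding spec by blast
    have "2 * (z\<^sup>2 - ?s * z - 1) = 2 * z\<^sup>2 - (- ?s - z) * (- ?s - ?s) + 2 * (?s\<^sup>2 - 1)"
      by (simp add: algebra_simps power2_eq_square)
    also have "\<dots> = 0" unfolding z2 s2' by simp
    finally have "z\<^sup>2 - ?s * z - 1 = 0" by (simp only: mult_eq_0_iff) simp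
    then show False using z avoid by blast
  qed
  moreover have "finite ?M" 
    by (rule card_ge_0_finite) (unfold card_M, simp)
  ultimately have "card (insert (- ?s) ?M) = Suc (card ?M)"
    by (rule card_insert_disjoint[rotated])
  also have "\<dots> = 5" unfolding card_M by simp
  finally show ?thesis .
qed

section \<open>Coronas with one-vertex and two-vertex complete graphs\<close>

lemma zero_notin_adj_spectrum:
  assumes "signed_graph S" "card (adj_spectrum S vs) = 2"
  shows "0 \<notin> adj_spectrum S vs"
  using assms by (cases rule: two_adj_eigenvalues) auto

theorem theorem5p2:
  fixes S :: "'a sgraph" and vs :: "'a list"
  assumes "signed_graph S"
    and "card (verts S) \<ge> 2"
    and "vertex_enum S vs"
    and "card (adj_spectrum S vs) = 2"
  shows "(\<forall>(T :: 'b sgraph) ws. signed_complete_graph 1 T \<longrightarrow> vertex_enum (S \<star>\<^sub>s T) ws \<longrightarrow>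
            card (adj_spectrum (S \<star>\<^sub>s T) ws) = 4) \<and>
         (\<forall>(T :: 'c sgraph) ws. signed_complete_graph 2 T \<longrightarrow> vertex_enum (S \<star>\<^sub>s T) ws \<longrightarrow>
            card (adj_spectrum (S \<star>\<^sub>s T) ws) = 5)"
proof (intro conjI allI impI)
  have ne: "verts S \<noteq> {}" using assms(2) by auto
  note corona = adj_spectrum_s_corona[OF assms(1) ne assms(3) zero_notin_adj_spectrum[OF assms(1,4)]]
  fix T :: "'b sgraph" and ws
  assume T: "signed_complete_graph 1 T" and ws: "vertex_enum (S \<star>\<^sub>s T) ws"
  have sg: "signed_graph T" using T by (simp add: signed_complete_graph_def)
  obtain u where u: "verts T = {u}"
    using T by (auto simp: signed_complete_graph_def card_1_singleton_iff)
  have "{u} \<notin> edges T" using sg by (auto simp: signed_graph_def)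
  then have "adj_app T (\<lambda>_. 1) v = 0" if "v \<in> verts T" for v
    using that u by (simp add: adj_app_def adj_def)
  \<comment> \<open>A function with sum zero on a single vertex vanishes there, so the second set of
    \<open>corona\<close> is empty.\<close>
  then have "adj_spectrum (S \<star>\<^sub>s T) ws =
      {\<mu>. \<exists>\<theta>\<in>adj_spectrum S vs. (\<mu> - \<theta>) * \<mu> = \<theta>\<^sup>2}"
    by (subst corona[OF sg _ _ ws, of 0]) (auto simp: u eigenfun_def)
  then show "card (adj_spectrum (S \<star>\<^sub>s T) ws) = 4"
    using card_corona_K1_values[OF assms(1,4)] by simp
next
  have ne: "verts S \<noteq> {}" using assms(2) by auto
  note corona = adj_spectrum_s_corona[OF assms(1) ne assms(3) zero_notin_adj_spectrum[OF assms(1,4)]]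
  fix T :: "'c sgraph" and ws
  assume T: "signed_complete_graph 2 T" and ws: "vertex_enum (S \<star>\<^sub>s T) ws"
  have sg: "signed_graph T" using T by (simp add: signed_complete_graph_def)
  obtain u w where uw: "verts T = {u, w}" "u \<noteq> w"
    using T by (auto simp: signed_complete_graph_def card_2_iff)
  define s where "s = sign T {u, w}"
  have edge: "{u, w} \<in> edges T" using T uw by (simp add: signed_complete_graph_def)
  then have s: "s \<in> {- 1, 1}" using sg unfolding signed_graph_def s_def by blast
  have "{v} \<notin> edges T" for v using sg by (auto simp: signed_graph_def)
  then have adj: "adj T u u = 0" "adj T w w = 0" "adj T u w = of_int s" "adj T w u = of_int s"
    using edge by (simp_all add: adj_def s_def insert_commute)
  have app: "adj_app T y u = of_int s * y w" "adj_app T y w = of_int s * y u" for y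
    using uw adj by (simp_all add: adj_app_def)
  \<comment> \<open>On two vertices the functions with sum zero are the multiples of (1, -1), which
    yields the fifth eigenvalue.\<close>
  have "(\<exists>y. eigenfun T \<mu> y \<and> (\<Sum>v\<in>verts T. y v) = 0) \<longleftrightarrow> \<mu> = - of_int s" for \<mu>
  proof
    assume "\<exists>y. eigenfun T \<mu> y \<and> (\<Sum>v\<in>verts T. y v) = 0"
    then obtain y where y: "y u \<noteq> 0 \<or> y w \<noteq> 0" "of_int s * y w = \<mu> * y u" "y w = - y u"
      using uw by (auto simp: eigenfun_def app add_eq_0_iff)
    then have "\<mu> * y u = - (of_int s * y u)" by simp
    then have "(\<mu> + of_int s) * y u = 0" by (simp add: distrib_right)
    then show "\<mu> = - of_int s" using y by (auto simp: add_eq_0_iff2)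
  next
    assume "\<mu> = - of_int s"
    then have "eigenfun T \<mu> (\<lambda>v. if v = u then 1 else - 1)"
      using uw by (auto simp: eigenfun_def app)
    then show "\<exists>y. eigenfun T \<mu> y \<and> (\<Sum>v\<in>verts T. y v) = 0"
      using uw by (intro exI[of _ "\<lambda>v. if v = u then 1 else - 1"]) simp
  qed
  moreover have "adj_app T (\<lambda>_. 1) v = of_int s" if "v \<in> verts T" for v
    using that uw app by auto
  ultimately have "adj_spectrum (S \<star>\<^sub>s T) ws = insert (- of_int s)
      {\<mu>. \<exists>\<theta>\<in>adj_spectrum S vs. (\<mu> - \<theta>) * (\<mu> - of_int s) = 2 * \<theta>\<^sup>2}"
    by (subst corona[OF sg _ _ ws, of "of_int s"]) (auto simp: uw)
  then show "card (adj_spectrum (S \<star>\<^sub>s T) ws) = 5"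
    using card_corona_K2_values[OF assms(1,4) s] by simp
qed

end
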